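(* Suppose intuitionistic Tarski geometry with Skolem functions proves $P(x)\to\exists y\,\varphi(x,y)$, where $P$ is negative (contains neither $\exists$ nor $\lor$; $x$ may stand for several variables). Then there is a term $t(x)$ of intuitionistic Tarski geometry with Skolem functions such that $P(x)\to\varphi(x,t(x))$ is provable (in the same theory).
   Context: Language: one sort (points), equality, strict betweenness $B(a,b,c)$, congruence $E(a,b,c,d)$ written $ab=cd$, constants $\alpha,\beta,\gamma$, and (total) function symbols $ext$ (4-ary), $ip$ (5-ary), $center$ (3-ary), $ilc_1,ilc_2$ (4-ary). Abbreviations: $T(a,b,c):=\neg(a\neq b\land b\neq c\land\neg B(a,b,c))$; $Col(a,b,c):=\neg(\neg T(c,a,b)\land\neg T(a,c,b)\land\neg T(a,b,c))$; $SameOrder(a,b,c,d):=(T(c,a,b)\to\neg B(d,c,a))\land(T(a,c,b)\to\neg B(d,c,b))\land(T(a,b,c)\to T(a,c,d))$. Intuitionistic Tarski geometry with Skolem functions has intuitionistic predicate logic with equality and the quantifier-free axioms: (A1) $ab=ba$; (A2) $ab=pq\land ab=rs\to pq=rs$; (A3) $ab=cc\to a=b$; (A4-i) $q\neq a\to T(q,a,x)\land ax=bc$ with $x=ext(q,a,b,c)$; (A5) $a\neq b\land T(a,b,c)\land T(A,B,C)\land ab=AB\land bc=BC\land ad=AD\land bd=BD\to cd=CD$; (A6-i) $\neg B(a,b,a)$; (A7-i) $B(a,p,c)\land T(b,q,c)\land\neg Col(a,b,c)\to B(p,x,b)\land B(q,x,a)$ with $x=ip(a,p,c,b,q)$; (A8)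 $\neg Col(\alpha,\beta,\gamma)$; (A9) $a\neq b\land pa=pb\land qa=qb\land ra=rb\to Col(p,q,r)$; (A10$_3$) $\neg Col(a,b,c)\to ax=bx\land ax=cx$ with $x=center(a,b,c)$; (A14-i) $B(a,b,c)\to B(c,b,a)$; (A15-i) $B(a,b,d)\land B(b,c,d)\to B(a,b,c)$; two-point line-circle: with $y=ilc_1(u,v,a,b)$, $z=ilc_2(u,v,a,b)$: $Col(u,v,p)\land u\neq v\land T(a,p,b)\to Col(u,v,y)\land Col(u,v,z)\land ay=ab\land az=ab\land T(y,p,z)\land(p\neq a\to y\neq z)$, and $u\neq v\to SameOrder(u,v,y,z)$; stability: $\neg\neg B(a,b,c)\to B(a,b,c)$, $\neg\neg ab=cd\to ab=cd$, $\neg a\neq b\to a=b$. *)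

theory Defs
  imports Main
begin

section \<open>Syntax\<close>

text \<open>
  Variables are de Bruijn indices: below \<open>k\<close> quantifiers, \<^term>\<open>Var (n + k)\<close> is the free
  variable number \<open>n\<close>.
\<close>

datatype tm =
    Var nat
  | Alpha | Beta | Gamma
  | Ext tm tm tm tm
  | Ip tm tm tm tm tm
  | Center tm tm tm
  | Ilc1 tm tm tm tm
  | Ilc2 tm tm tm tm

datatype fm =
    Bot
  | Eq tm tm
  | Bet tm tm tm
  | Cong tm tm tm tm
  | And fm fm  (infixr \<open>\<^bold>\<and>\<close> 35)
  | Or fm fm  (infixr \<open>\<^bold>\<or>\<close> 30)
  | Imp fm fm  (infixr \<open>\<^bold>\<longrightarrow>\<close> 25)
  | Forall fm
  | Exists fm

abbreviation Neg :: "fm \<Rightarrow> fm"  (\<open>\<^bold>\<not> _\<close> [40] 40) where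
  "\<^bold>\<not> A \<equiv> A \<^bold>\<longrightarrow> Bot"

primrec fv_tm :: "tm \<Rightarrow> nat set" where
  "fv_tm (Var n) = {n}"
| "fv_tm Alpha = {}"
| "fv_tm Beta = {}"
| "fv_tm Gamma = {}"
| "fv_tm (Ext a b c d) = fv_tm a \<union> fv_tm b \<union> fv_tm c \<union> fv_tm d"
| "fv_tm (Ip a b c d e) = fv_tm a \<union> fv_tm b \<union> fv_tm c \<union> fv_tm d \<union> fv_tm e"
| "fv_tm (Center a b c) = fv_tm a \<union> fv_tm b \<union> fv_tm c"
| "fv_tm (Ilc1 a b c d) = fv_tm a \<union> fv_tm b \<union> fv_tm c \<union> fv_tm d"
| "fv_tm (Ilc2 a b c d) = fv_tm a \<union> fv_tm b \<union> fv_tm c \<union> fv_tm d"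

primrec fv :: "fm \<Rightarrow> nat set" where
  "fv Bot = {}"
| "fv (Eq a b) = fv_tm a \<union> fv_tm b"
| "fv (Bet a b c) = fv_tm a \<union> fv_tm b \<union> fv_tm c"
| "fv (Cong a b c d) = fv_tm a \<union> fv_tm b \<union> fv_tm c \<union> fv_tm d"
| "fv (A \<^bold>\<and> B) = fv A \<union> fv B"
| "fv (A \<^bold>\<or> B) = fv A \<union> fv B"
| "fv (A \<^bold>\<longrightarrow> B) = fv A \<union> fv B"
| "fv (Forall A) = {n. Suc n \<in> fv A}"
| "fv (Exists A) = {n. Suc n \<in> fv A}"

primrec subst_tm :: "(nat \<Rightarrow> tm) \<Rightarrow> tm \<Rightarrow> tm" where
  "subst_tm \<sigma> (Var n) = \<sigma> n"
| "subst_tm \<sigma> Alpha = Alpha"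
| "subst_tm \<sigma> Beta = Beta"
| "subst_tm \<sigma> Gamma = Gamma"
| "subst_tm \<sigma> (Ext a b c d) = Ext (subst_tm \<sigma> a) (subst_tm \<sigma> b) (subst_tm \<sigma> c) (subst_tm \<sigma> d)"
| "subst_tm \<sigma> (Ip a b c d e) =
    Ip (subst_tm \<sigma> a) (subst_tm \<sigma> b) (subst_tm \<sigma> c) (subst_tm \<sigma> d) (subst_tm \<sigma> e)"
| "subst_tm \<sigma> (Center a b c) = Center (subst_tm \<sigma> a) (subst_tm \<sigma> b) (subst_tm \<sigma> c)"
| "subst_tm \<sigma> (Ilc1 a b c d) = Ilc1 (subst_tm \<sigma> a) (subst_tm \<sigma> b) (subst_tm \<sigma> c) (subst_tm \<sigma> d)"
| "subst_tm \<sigma> (Ilc2 a b c d) = Ilc2 (subst_tm \<sigma> a) (subst_tm \<sigma> b) (subst_tm \<sigma> c) (subst_tm \<sigma> d)"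

text \<open>The substitution to apply to the body of a quantifier: it fixes the bound variable.\<close>

definition up :: "(nat \<Rightarrow> tm) \<Rightarrow> nat \<Rightarrow> tm" where
  "up \<sigma> n = (case n of 0 \<Rightarrow> Var 0 | Suc m \<Rightarrow> subst_tm (\<lambda>i. Var (Suc i)) (\<sigma> m))"

primrec subst :: "(nat \<Rightarrow> tm) \<Rightarrow> fm \<Rightarrow> fm" where
  "subst \<sigma> Bot = Bot"
| "subst \<sigma> (Eq a b) = Eq (subst_tm \<sigma> a) (subst_tm \<sigma> b)"
| "subst \<sigma> (Bet a b c) = Bet (subst_tm \<sigma> a) (subst_tm \<sigma> b) (subst_tm \<sigma> c)"
| "subst \<sigma> (Cong a b c d) = Cong (subst_tm \<sigma> a) (subst_tm \<sigma> b) (subst_tm \<sigma> c) (subst_tm \<sigma> d)"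
| "subst \<sigma> (A \<^bold>\<and> B) = (subst \<sigma> A \<^bold>\<and> subst \<sigma> B)"
| "subst \<sigma> (A \<^bold>\<or> B) = (subst \<sigma> A \<^bold>\<or> subst \<sigma> B)"
| "subst \<sigma> (A \<^bold>\<longrightarrow> B) = (subst \<sigma> A \<^bold>\<longrightarrow> subst \<sigma> B)"
| "subst \<sigma> (Forall A) = Forall (subst (up \<sigma>) A)"
| "subst \<sigma> (Exists A) = Exists (subst (up \<sigma>) A)"

definition lift :: "fm \<Rightarrow> fm" where
  "lift A = subst (\<lambda>n. Var (Suc n)) A"

text \<open>
  \<open>inst t A\<close> replaces the variable \<open>0\<close> of \<open>A\<close> by \<open>t\<close> and lowers the other free variables
  by one; thus \<open>inst t A\<close> is the instance of \<^term>\<open>Forall A\<close> or \<^term>\<open>Exists A\<close> at \<open>t\<close>.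
\<close>

definition inst :: "tm \<Rightarrow> fm \<Rightarrow> fm" where
  "inst t A = subst (\<lambda>n. case n of 0 \<Rightarrow> t | Suc m \<Rightarrow> Var m) A"

primrec negative :: "fm \<Rightarrow> bool" where
  "negative Bot \<longleftrightarrow> True"
| "negative (Eq a b) \<longleftrightarrow> True"
| "negative (Bet a b c) \<longleftrightarrow> True"
| "negative (Cong a b c d) \<longleftrightarrow> True"
| "negative (A \<^bold>\<and> B) \<longleftrightarrow> negative A \<and> negative B"
| "negative (A \<^bold>\<or> B) \<longleftrightarrow> False"
| "negative (A \<^bold>\<longrightarrow> B) \<longleftrightarrow> negative A \<and> negative B"
| "negative (Forall A) \<longleftrightarrow> negative A"
| "negative (Exists A) \<longleftrightarrow> False"


section \<open>Intuitionistic predicate logic with equality\<close>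

text \<open>
  Natural deduction from a set \<open>Ax\<close> of axioms and a list of local hypotheses. The free
  variables of an axiom are read universally, so \<open>AllI\<close> and \<open>ExE\<close> restrict only the local
  hypotheses.
\<close>

inductive derives :: "fm set \<Rightarrow> fm list \<Rightarrow> fm \<Rightarrow> bool" for Ax :: "fm set" where
  Axiom: "A \<in> Ax \<Longrightarrow> derives Ax \<Gamma> A"
| Hyp: "A \<in> set \<Gamma> \<Longrightarrow> derives Ax \<Gamma> A"
| BotE: "derives Ax \<Gamma> Bot \<Longrightarrow> derives Ax \<Gamma> A"
| AndI: "derives Ax \<Gamma> A \<Longrightarrow> derives Ax \<Gamma> B \<Longrightarrow> derives Ax \<Gamma> (A \<^bold>\<and> B)"
| AndE1: "derives Ax \<Gamma> (A \<^bold>\<and> B) \<Longrightarrow> derives Ax \<Gamma> A"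
| AndE2: "derives Ax \<Gamma> (A \<^bold>\<and> B) \<Longrightarrow> derives Ax \<Gamma> B"
| OrI1: "derives Ax \<Gamma> A \<Longrightarrow> derives Ax \<Gamma> (A \<^bold>\<or> B)"
| OrI2: "derives Ax \<Gamma> B \<Longrightarrow> derives Ax \<Gamma> (A \<^bold>\<or> B)"
| OrE: "derives Ax \<Gamma> (A \<^bold>\<or> B) \<Longrightarrow> derives Ax (A # \<Gamma>) C \<Longrightarrow> derives Ax (B # \<Gamma>) C \<Longrightarrow>
    derives Ax \<Gamma> C"
| ImpI: "derives Ax (A # \<Gamma>) B \<Longrightarrow> derives Ax \<Gamma> (A \<^bold>\<longrightarrow> B)"
| ImpE: "derives Ax \<Gamma> (A \<^bold>\<longrightarrow> B) \<Longrightarrow> derives Ax \<Gamma> A \<Longrightarrow> derives Ax \<Gamma> B"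
| AllI: "derives Ax (map lift \<Gamma>) A \<Longrightarrow> derives Ax \<Gamma> (Forall A)"
| AllE: "derives Ax \<Gamma> (Forall A) \<Longrightarrow> derives Ax \<Gamma> (inst t A)"
| ExI: "derives Ax \<Gamma> (inst t A) \<Longrightarrow> derives Ax \<Gamma> (Exists A)"
| ExE: "derives Ax \<Gamma> (Exists A) \<Longrightarrow> derives Ax (A # map lift \<Gamma>) (lift C) \<Longrightarrow> derives Ax \<Gamma> C"
| EqI: "derives Ax \<Gamma> (Eq t t)"
| EqE: "derives Ax \<Gamma> (Eq s t) \<Longrightarrow> derives Ax \<Gamma> (inst s A) \<Longrightarrow> derives Ax \<Gamma> (inst t A)"


section \<open>Intuitionistic Tarski geometry with Skolem functions\<close>

text \<open>Non-strict betweenness.\<close>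

definition TBet :: "tm \<Rightarrow> tm \<Rightarrow> tm \<Rightarrow> fm" where
  "TBet a b c = (\<^bold>\<not> (\<^bold>\<not> Eq a b \<^bold>\<and> \<^bold>\<not> Eq b c \<^bold>\<and> \<^bold>\<not> Bet a b c))"

definition Col :: "tm \<Rightarrow> tm \<Rightarrow> tm \<Rightarrow> fm" where
  "Col a b c = (\<^bold>\<not> (\<^bold>\<not> TBet c a b \<^bold>\<and> \<^bold>\<not> TBet a c b \<^bold>\<and> \<^bold>\<not> TBet a b c))"

definition SameOrder :: "tm \<Rightarrow> tm \<Rightarrow> tm \<Rightarrow> tm \<Rightarrow> fm" where
  "SameOrder a b c d =
    ((TBet c a b \<^bold>\<longrightarrow> \<^bold>\<not> Bet d c a) \<^bold>\<and>
     (TBet a c b \<^bold>\<longrightarrow> \<^bold>\<not> Bet d c b) \<^bold>\<and>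
     (TBet a b c \<^bold>\<longrightarrow> TBet a c d))"

text \<open>
  The lower-case letters below range over arbitrary terms, so \<open>tarski\<close> consists of all
  substitution instances of the open axioms.
\<close>

inductive_set tarski :: "fm set" where
  A1: "Cong a b b a \<in> tarski"
| A2: "(Cong a b p q \<^bold>\<and> Cong a b r s \<^bold>\<longrightarrow> Cong p q r s) \<in> tarski"
| A3: "(Cong a b c c \<^bold>\<longrightarrow> Eq a b) \<in> tarski"
| A4: "x = Ext q a b c \<Longrightarrow>
    (\<^bold>\<not> Eq q a \<^bold>\<longrightarrow> TBet q a x \<^bold>\<and> Cong a x b c) \<in> tarski"
| A5: "(\<^bold>\<not> Eq a b \<^bold>\<and> TBet a b c \<^bold>\<and> TBet a' b' c' \<^bold>\<and> Cong a b a' b' \<^bold>\<and> Cong b c b' c' \<^bold>\<and>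
      Cong a d a' d' \<^bold>\<and> Cong b d b' d' \<^bold>\<longrightarrow> Cong c d c' d') \<in> tarski"
| A6: "(\<^bold>\<not> Bet a b a) \<in> tarski"
| A7: "x = Ip a p c b q \<Longrightarrow>
    (Bet a p c \<^bold>\<and> TBet b q c \<^bold>\<and> \<^bold>\<not> Col a b c \<^bold>\<longrightarrow> Bet p x b \<^bold>\<and> Bet q x a) \<in> tarski"
| A8: "(\<^bold>\<not> Col Alpha Beta Gamma) \<in> tarski"
| A9: "(\<^bold>\<not> Eq a b \<^bold>\<and> Cong p a p b \<^bold>\<and> Cong q a q b \<^bold>\<and> Cong r a r b \<^bold>\<longrightarrow> Col p q r) \<in> tarski"
| A10: "x = Center a b c \<Longrightarrow>
    (\<^bold>\<not> Col a b c \<^bold>\<longrightarrow> Cong a x b x \<^bold>\<and> Cong a x c x) \<in> tarski"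
| A14: "(Bet a b c \<^bold>\<longrightarrow> Bet c b a) \<in> tarski"
| A15: "(Bet a b d \<^bold>\<and> Bet b c d \<^bold>\<longrightarrow> Bet a b c) \<in> tarski"
| LineCircle: "y = Ilc1 u v a b \<Longrightarrow> z = Ilc2 u v a b \<Longrightarrow>
    (Col u v p \<^bold>\<and> \<^bold>\<not> Eq u v \<^bold>\<and> TBet a p b \<^bold>\<longrightarrow>
      Col u v y \<^bold>\<and> Col u v z \<^bold>\<and> Cong a y a b \<^bold>\<and> Cong a z a b \<^bold>\<and> TBet y p z \<^bold>\<and>
      (\<^bold>\<not> Eq p a \<^bold>\<longrightarrow> \<^bold>\<not> Eq y z)) \<in> tarski"
| LineCircle_order: "y = Ilc1 u v a b \<Longrightarrow> z = Ilc2 u v a b \<Longrightarrow>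
    (\<^bold>\<not> Eq u v \<^bold>\<longrightarrow> SameOrder u v y z) \<in> tarski"
| Stable_Bet: "(\<^bold>\<not> \<^bold>\<not> Bet a b c \<^bold>\<longrightarrow> Bet a b c) \<in> tarski"
| Stable_Cong: "(\<^bold>\<not> \<^bold>\<not> Cong a b c d \<^bold>\<longrightarrow> Cong a b c d) \<in> tarski"
| Stable_Eq: "(\<^bold>\<not> \<^bold>\<not> Eq a b \<^bold>\<longrightarrow> Eq a b) \<in> tarski"

definition provable :: "fm \<Rightarrow> bool" where
  "provable A \<longleftrightarrow> derives tarski [] A"

end

theory Submission
  imports Defs
begin

text \<open>
  The proof uses Aczel's variant of Kleene's slash for derivability from \<open>P\<close>: a slashed formula
  is derivable, and a slashed disjunction or existential has a slashed disjunct or instance.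
  Absurdity counts as slashed when it is derivable, so consistency is never needed. The slash
  agrees with derivability on negative formulas, hence holds of \<open>P\<close> and of the axioms, and it is
  preserved by all rules. So \<open>Exists \<phi>\<close> is slashed, which yields the term. Variables of that term
  that do not occur in \<open>xs\<close> are replaced by the constant \<open>Alpha\<close>.
\<close>

section \<open>Substitution\<close>

lemma subst_tm_comp: "subst_tm \<sigma> (subst_tm \<tau> t) = subst_tm (\<lambda>n. subst_tm \<sigma> (\<tau> n)) t"
  by (induction t) auto

lemma subst_tm_Var [simp]: "subst_tm Var t = t"
  by (induction t) auto

lemma up_simps [simp]:
  "up \<sigma> 0 = Var 0"
  "up \<sigma> (Suc n) = subst_tm (\<lambda>i. Var (Suc i)) (\<sigma> n)"
  by (simp_all add: up_def)

lemma up_comp: "(\<lambda>n. subst_tm (up \<sigma>) (up \<tau> n)) = up (\<lambda>n. subst_tm \<sigma> (\<tau> n))"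
proof
  show "subst_tm (up \<sigma>) (up \<tau> n) = up (\<lambda>n. subst_tm \<sigma> (\<tau> n)) n" for n
    by (cases n) (simp_all add: subst_tm_comp)
qed

lemma subst_comp: "subst \<sigma> (subst \<tau> A) = subst (\<lambda>n. subst_tm \<sigma> (\<tau> n)) A"
  by (induction A arbitrary: \<sigma> \<tau>) (simp_all add: subst_tm_comp up_comp)

lemma up_Var [simp]: "up Var = Var"
proof
  show "up Var n = Var n" for n
    by (cases n) simp_all
qed

lemma subst_Var [simp]: "subst Var A = A"
  by (induction A) simp_all

lemma subst_tm_cong: "(\<And>n. n \<in> fv_tm t \<Longrightarrow> \<sigma> n = \<tau> n) \<Longrightarrow> subst_tm \<sigma> t = subst_tm \<tau> t"
  by (induction t) auto

lemma subst_cong: "(\<And>n. n \<in> fv A \<Longrightarrow> \<sigma> n = \<tau> n) \<Longrightarrow> subst \<sigma> A = subst \<tau> A"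
proof (induction A arbitrary: \<sigma> \<tau>)
  case (Forall A)
  have "up \<sigma> n = up \<tau> n" if "n \<in> fv A" for n
    using that Forall.prems by (cases n) simp_all
  then show ?case using Forall.IH[of "up \<sigma>" "up \<tau>"] by simp
next
  case (Exists A)
  have "up \<sigma> n = up \<tau> n" if "n \<in> fv A" for n
    using that Exists.prems by (cases n) simp_all
  then show ?case using Exists.IH[of "up \<sigma>" "up \<tau>"] by simp
next
  case (And A B)
  then show ?case by (metis UnCI fv.simps(5) subst.simps(5))
next
  case (Or A B)
  then show ?case by (metis UnCI fv.simps(6) subst.simps(6))
next
  case (Imp A B)
  then show ?case by (metis UnCI fv.simps(7) subst.simps(7))
qed (auto intro!: subst_tm_cong)

lemma fv_tm_subst_tm: "fv_tm (subst_tm \<sigma> t) = (\<Union>n\<in>fv_tm t. fv_tm (\<sigma> n))"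
  by (induction t) auto

text \<open>\<open>case_nat t \<sigma>\<close> serves throughout as the environment
  \<open>\<sigma>\<close> extended by the value \<open>t\<close> for the innermost bound variable.
  In this form instantiation composes with other substitutions through
  \<open>subst_comp\<close>.\<close>

lemma inst_eq: "inst t A = subst (case_nat t Var) A"
  by (simp add: inst_def)

lemma subst_tm_case_nat:
  "(\<lambda>n. subst_tm \<rho> (case_nat t \<sigma> n)) = case_nat (subst_tm \<rho> t) (\<lambda>n. subst_tm \<rho> (\<sigma> n))"
  by (auto split: nat.split)

lemma inst_subst_up: "inst t (subst (up \<sigma>) A) = subst (case_nat t \<sigma>) A"
proof -
  have "subst_tm (case_nat t Var) (up \<sigma> n) = case_nat t \<sigma> n" for n
    by (cases n) (simp_all add: subst_tm_comp)
  then show ?thesis by (simp add: inst_eq subst_comp)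
qed

lemma subst_inst: "subst \<sigma> (inst t A) = subst (case_nat (subst_tm \<sigma> t) \<sigma>) A"
  by (simp add: inst_eq subst_comp subst_tm_case_nat)

lemma subst_inst_up: "subst \<sigma> (inst t A) = inst (subst_tm \<sigma> t) (subst (up \<sigma>) A)"
  by (simp add: subst_inst inst_subst_up)

lemma subst_lift: "subst \<sigma> (lift A) = subst (\<lambda>n. \<sigma> (Suc n)) A"
  by (simp add: lift_def subst_comp)

lemma subst_up_lift: "subst (up \<sigma>) (lift A) = lift (subst \<sigma> A)"
  by (simp add: subst_lift) (simp add: lift_def subst_comp)


section \<open>Admissible rules\<close>

text \<open>Contexts matter only as sets, so exchange and contraction are included. The larger
  context stays arbitrary in the induction because some rules extend or lift it.\<close>

lemma derives_weaken: "derives Ax \<Gamma> A \<Longrightarrow> set \<Gamma> \<subseteq> set \<Delta> \<Longrightarrow> derives Ax \<Delta> A"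
proof (induction arbitrary: \<Delta> rule: derives.induct)
  case (OrE \<Gamma> A B C)
  have "derives Ax (A # \<Delta>) C" and "derives Ax (B # \<Delta>) C"
    using OrE.prems OrE.IH(2)[of "A # \<Delta>"] OrE.IH(3)[of "B # \<Delta>"] by auto
  with OrE.IH(1)[OF OrE.prems] show ?case by (rule derives.OrE)
next
  case (ImpI A \<Gamma> B)
  then show ?case by (intro derives.ImpI ImpI.IH) auto
next
  case (AllI \<Gamma> A)
  then show ?case by (intro derives.AllI AllI.IH) auto
next
  case (ExE \<Gamma> A C)
  have "derives Ax (A # map lift \<Delta>) (lift C)"
    using ExE.prems by (intro ExE.IH) auto
  with ExE.IH(1)[OF ExE.prems] show ?case by (rule derives.ExE)
next
  case (EqE \<Gamma> s t A)
  show ?case by (rule derives.EqE[OF EqE.IH(1,2)[OF EqE.prems]])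
next
  case (BotE \<Gamma> A)
  show ?case by (rule derives.BotE[OF BotE.IH[OF BotE.prems]])
next
  case (AndE1 \<Gamma> A B)
  show ?case by (rule derives.AndE1[OF AndE1.IH[OF AndE1.prems]])
next
  case (AndE2 \<Gamma> A B)
  show ?case by (rule derives.AndE2[OF AndE2.IH[OF AndE2.prems]])
next
  case (ImpE \<Gamma> A B)
  show ?case by (rule derives.ImpE[OF ImpE.IH(1,2)[OF ImpE.prems]])
next
  case (AllE \<Gamma> A t)
  show ?case by (rule derives.AllE[OF AllE.IH[OF AllE.prems]])
next
  case (ExI \<Gamma> t A)
  show ?case by (rule derives.ExI[OF ExI.IH[OF ExI.prems]])
qed (auto intro: derives.Axiom derives.Hyp derives.AndI derives.OrI1 derives.OrI2 derives.EqI)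

text \<open>Induction on the context: each hypothesis is discharged by \<open>ImpI\<close> and
  supplied again by \<open>ImpE\<close>. No quantifier rule is inspected, so \<open>Ax\<close> may
  be any set.\<close>

lemma derives_cut:
  "derives Ax \<Gamma> A \<Longrightarrow> (\<And>B. B \<in> set \<Gamma> \<Longrightarrow> derives Ax \<Delta> B) \<Longrightarrow> derives Ax \<Delta> A"
proof (induction \<Gamma> arbitrary: A)
  case Nil
  then show ?case using derives_weaken[of Ax "[]"] by simp
next
  case (Cons B \<Gamma>)
  have "derives Ax \<Delta> (B \<^bold>\<longrightarrow> A)"
    by (rule Cons.IH[OF derives.ImpI[OF Cons.prems(1)]]) (simp add: Cons.prems(2))
  then show ?case by (rule derives.ImpE) (simp add: Cons.prems(2))
qed

lemma derives_sym:
  assumes "derives Ax \<Gamma> (Eq s t)"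
  shows "derives Ax \<Gamma> (Eq t s)"
proof -
  \<comment> \<open>The formula "x = s", with \<open>s\<close> shifted past variable 0: its instance
    at \<open>s\<close> is reflexivity, its instance at \<open>t\<close> is the goal.\<close>
  define A where "A = Eq (Var 0) (subst_tm (\<lambda>n. Var (Suc n)) s)"
  have inst_A: "inst u A = Eq u s" for u
    by (simp add: A_def inst_eq subst_tm_comp)
  have "derives Ax \<Gamma> (inst s A)"
    by (simp add: inst_A derives.EqI)
  from derives.EqE[OF assms this] show ?thesis
    by (simp add: inst_A)
qed

text \<open>Axioms can be used at any leaf, so their set has to be closed under substitution. In
  \<open>AllI\<close> and \<open>ExE\<close> the induction hypothesis is taken at
  \<open>up \<sigma>\<close>, which commutes with lifting the context.\<close>

lemma derives_subst:
  assumes closed: "\<And>A \<sigma>. A \<in> Ax \<Longrightarrow> subst \<sigma> A \<in> Ax"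
  shows "derives Ax \<Gamma> A \<Longrightarrow> derives Ax (map (subst \<sigma>) \<Gamma>) (subst \<sigma> A)"
proof (induction arbitrary: \<sigma> rule: derives.induct)
  case (AllI \<Gamma> A)
  from AllI.IH[of "up \<sigma>"] show ?case
    by (auto intro!: derives.AllI simp: subst_up_lift o_def)
next
  case (AllE \<Gamma> A t)
  from derives.AllE[OF AllE.IH[of \<sigma>, unfolded subst.simps]] show ?case
    by (simp add: subst_inst_up)
next
  case (ExI \<Gamma> t A)
  from derives.ExI[OF ExI.IH[of \<sigma>, unfolded subst_inst_up]] show ?case
    by simp
next
  case (ExE \<Gamma> A C)
  from ExE.IH(2)[of "up \<sigma>"]
  have "derives Ax (subst (up \<sigma>) A # map lift (map (subst \<sigma>) \<Gamma>)) (lift (subst \<sigma> C))"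
    by (simp add: subst_up_lift o_def)
  with ExE.IH(1)[of \<sigma>, unfolded subst.simps] show ?case by (rule derives.ExE)
next
  case (EqE \<Gamma> s t A)
  from derives.EqE[OF EqE.IH(1)[of \<sigma>, unfolded subst.simps] EqE.IH(2)[of \<sigma>, unfolded subst_inst_up]]
  show ?case by (simp add: subst_inst_up)
next
  case (OrE \<Gamma> A B C)
  from OrE.IH[of \<sigma>, unfolded subst.simps list.map] show ?case
    by (rule derives.OrE)
next
  case (Axiom A \<Gamma>)
  then show ?case by (intro derives.Axiom closed)
next
  case (AndE1 \<Gamma> A B)
  from AndE1.IH[of \<sigma>, unfolded subst.simps] show ?case by (rule derives.AndE1)
next
  case (AndE2 \<Gamma> A B)
  from AndE2.IH[of \<sigma>, unfolded subst.simps] show ?case by (rule derives.AndE2)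
next
  case (ImpE \<Gamma> A B)
  from ImpE.IH[of \<sigma>, unfolded subst.simps] show ?case by (rule derives.ImpE)
next
  case (BotE \<Gamma> A)
  from BotE.IH[of \<sigma>, unfolded subst.simps] show ?case by (rule derives.BotE)
qed (simp_all add: derives.Hyp derives.AndI derives.OrI1 derives.OrI2 derives.ImpI derives.EqI)


section \<open>The slash\<close>

text \<open>
  \<open>slash Ax \<Delta> A \<sigma>\<close> says that \<open>subst \<sigma> A\<close> is slashed; keeping the substitution as
  an argument makes the definition structurally recursive.
\<close>

primrec slash :: "fm set \<Rightarrow> fm list \<Rightarrow> fm \<Rightarrow> (nat \<Rightarrow> tm) \<Rightarrow> bool" where
  "slash Ax \<Delta> Bot \<sigma> \<longleftrightarrow> derives Ax \<Delta> Bot"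
| "slash Ax \<Delta> (Eq a b) \<sigma> \<longleftrightarrow> derives Ax \<Delta> (subst \<sigma> (Eq a b))"
| "slash Ax \<Delta> (Bet a b c) \<sigma> \<longleftrightarrow> derives Ax \<Delta> (subst \<sigma> (Bet a b c))"
| "slash Ax \<Delta> (Cong a b c d) \<sigma> \<longleftrightarrow> derives Ax \<Delta> (subst \<sigma> (Cong a b c d))"
| "slash Ax \<Delta> (A \<^bold>\<and> B) \<sigma> \<longleftrightarrow> slash Ax \<Delta> A \<sigma> \<and> slash Ax \<Delta> B \<sigma>"
| "slash Ax \<Delta> (A \<^bold>\<or> B) \<sigma> \<longleftrightarrow> slash Ax \<Delta> A \<sigma> \<or> slash Ax \<Delta> B \<sigma>"
| "slash Ax \<Delta> (A \<^bold>\<longrightarrow> B) \<sigma> \<longleftrightarrow>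
    derives Ax \<Delta> (subst \<sigma> (A \<^bold>\<longrightarrow> B)) \<and> (slash Ax \<Delta> A \<sigma> \<longrightarrow> slash Ax \<Delta> B \<sigma>)"
| "slash Ax \<Delta> (Forall A) \<sigma> \<longleftrightarrow>
    derives Ax \<Delta> (subst \<sigma> (Forall A)) \<and> (\<forall>t. slash Ax \<Delta> A (case_nat t \<sigma>))"
| "slash Ax \<Delta> (Exists A) \<sigma> \<longleftrightarrow> (\<exists>t. slash Ax \<Delta> A (case_nat t \<sigma>))"

text \<open>Justifies reading \<open>slash Ax \<Delta> A \<sigma>\<close> as a property of
  \<open>subst \<sigma> A\<close>, and yields the instance and lifting laws that the quantifier
  rules need.\<close>

lemma slash_subst: "slash Ax \<Delta> (subst \<tau> A) \<sigma> \<longleftrightarrow> slash Ax \<Delta> A (\<lambda>n. subst_tm \<sigma> (\<tau> n))"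
proof -
  have up: "(\<lambda>n. subst_tm (case_nat t \<sigma>) (up \<tau> n)) = case_nat t (\<lambda>n. subst_tm \<sigma> (\<tau> n))"
    for t \<sigma> \<tau>
  proof
    show "subst_tm (case_nat t \<sigma>) (up \<tau> n) = case_nat t (\<lambda>n. subst_tm \<sigma> (\<tau> n)) n" for n
      by (cases n) (simp_all add: subst_tm_comp)
  qed
  show ?thesis
    by (induction A arbitrary: \<sigma> \<tau>) (simp_all add: subst_tm_comp subst_comp up_comp up)
qed

lemma slash_inst:
  "slash Ax \<Delta> (inst t A) \<sigma> \<longleftrightarrow> slash Ax \<Delta> A (case_nat (subst_tm \<sigma> t) \<sigma>)"
  by (simp add: inst_eq slash_subst subst_tm_case_nat)

lemma slash_lift: "slash Ax \<Delta> (lift A) (case_nat t \<sigma>) \<longleftrightarrow> slash Ax \<Delta> A \<sigma>"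
  by (simp add: lift_def slash_subst)

text \<open>Implications and universals carry derivability in their clauses; the other compound
  formulas regain it from the introduction rules.\<close>

lemma slash_imp_derives: "slash Ax \<Delta> A \<sigma> \<Longrightarrow> derives Ax \<Delta> (subst \<sigma> A)"
proof (induction A arbitrary: \<sigma>)
  case (Exists A)
  then obtain t where "derives Ax \<Delta> (inst t (subst (up \<sigma>) A))"
    by (auto simp: inst_subst_up)
  then show ?case by (auto intro: derives.ExI)
qed (auto intro: derives.AndI derives.OrI1 derives.OrI2)

text \<open>The elimination rules take a derivable negative formula apart. For an implication, a
  slashed premise is derivable, so modus ponens derives the conclusion, which is then slashed by
  induction.\<close>

lemma negative_slash: "negative A \<Longrightarrow> derives Ax \<Delta> (subst \<sigma> A) \<Longrightarrow> slash Ax \<Delta> A \<sigma>"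
proof (induction A arbitrary: \<sigma>)
  case (And A B)
  then show ?case by (auto intro: derives.AndE1 derives.AndE2)
next
  case (Imp A B)
  have "slash Ax \<Delta> B \<sigma>" if "slash Ax \<Delta> A \<sigma>"
    using Imp.IH(2) Imp.prems derives.ImpE[OF _ slash_imp_derives[OF that]] by simp
  with Imp.prems show ?case by simp
next
  case (Forall A)
  have "derives Ax \<Delta> (subst (case_nat t \<sigma>) A)" for t
    using derives.AllE[of Ax \<Delta> "subst (up \<sigma>) A" t] Forall.prems by (simp add: inst_subst_up)
  with Forall show ?case by simp
qed auto

text \<open>Needed for \<open>BotE\<close>, since absurdity may be slashed: a context deriving it
  derives everything, so any disjunct and any witness will do.\<close>

lemma slash_explosion: "derives Ax \<Delta> Bot \<Longrightarrow> slash Ax \<Delta> A \<sigma>"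
  by (induction A arbitrary: \<sigma>) (use derives.BotE in auto)

text \<open>
  \<open>EqE\<close> replaces a single term at a time, so the two substitutions are given as a
  common one followed by the instantiation of one variable with equal terms.
\<close>

lemma slash_eq:
  assumes "derives Ax \<Delta> (Eq s t)"
    and "slash Ax \<Delta> A (\<lambda>n. subst_tm (case_nat s Var) (\<rho> n))"
  shows "slash Ax \<Delta> A (\<lambda>n. subst_tm (case_nat t Var) (\<rho> n))"
  using assms
proof (induction A arbitrary: s t \<rho>)
  have replace: "derives Ax \<Delta> (subst (\<lambda>n. subst_tm (case_nat t Var) (\<rho> n)) A)"
    if "derives Ax \<Delta> (Eq s t)"
      and "derives Ax \<Delta> (subst (\<lambda>n. subst_tm (case_nat s Var) (\<rho> n)) A)" for s t \<rho> A
    using derives.EqE[OF that(1), of "subst \<rho> A"] that(2) by (simp add: inst_eq subst_comp)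
  \<comment> \<open>Environment for a quantifier body: the value \<open>u\<close> of the bound
    variable is shifted so that instantiating variable 0 by \<open>s\<close> or by \<open>t\<close>
    leaves it unchanged.\<close>
  define \<eta> where "\<eta> u \<rho> = case_nat (subst_tm (\<lambda>n. Var (Suc n)) u) \<rho>" for u and \<rho> :: "nat \<Rightarrow> tm"
  have \<eta>: "(\<lambda>n. subst_tm (case_nat s Var) (\<eta> u \<rho> n)) =
      case_nat u (\<lambda>n. subst_tm (case_nat s Var) (\<rho> n))" for s u \<rho>
    by (simp add: \<eta>_def subst_tm_case_nat subst_tm_comp)
  {
    case Bot
    then show ?case by simp
  next
    case (Eq a b)
    then show ?case using replace[of s t _ "Eq a b"] by simp
  next
    case (Bet a b c)
    then show ?case using replace[of s t _ "Bet a b c"] by simp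
  next
    case (Cong a b c d)
    then show ?case using replace[of s t _ "Cong a b c d"] by simp
  next
    case (And A B)
    then show ?case by auto
  next
    case (Or A B)
    then show ?case by auto
  next
    case (Imp A B)
    \<comment> \<open>The premise is contravariant: it is carried back from \<open>t\<close> to
      \<open>s\<close> by symmetry of equality.\<close>
    have "slash Ax \<Delta> B (\<lambda>n. subst_tm (case_nat t Var) (\<rho> n))"
      if "slash Ax \<Delta> A (\<lambda>n. subst_tm (case_nat t Var) (\<rho> n))"
      using Imp.IH(1)[OF derives_sym that] Imp.IH(2) Imp.prems by simp
    then show ?case using Imp.prems replace[of s t _ "A \<^bold>\<longrightarrow> B"] by simp
  next
    case (Forall A)
    have "slash Ax \<Delta> A (case_nat u (\<lambda>n. subst_tm (case_nat t Var) (\<rho> n)))" for u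
      using Forall.IH[of s t "\<eta> u \<rho>"] Forall.prems by (simp add: \<eta>)
    then show ?case using Forall.prems replace[of s t _ "Forall A"] by simp
  next
    case (Exists A)
    then obtain u where "slash Ax \<Delta> A (case_nat u (\<lambda>n. subst_tm (case_nat s Var) (\<rho> n)))"
      by auto
    then have "slash Ax \<Delta> A (case_nat u (\<lambda>n. subst_tm (case_nat t Var) (\<rho> n)))"
      using Exists.IH[of s t "\<eta> u \<rho>"] Exists.prems by (simp add: \<eta>)
    then show ?case by (simp only: slash.simps) (rule exI)
  }
qed

text \<open>Negativity makes the axioms slashed, and closure makes their instances available. The
  environment is arbitrary because \<open>AllI\<close> and \<open>ExE\<close> extend it by a
  term.\<close>

lemma slash_sound:
  assumes closed: "\<And>A \<sigma>. A \<in> Ax \<Longrightarrow> subst \<sigma> A \<in> Ax"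
    and neg: "\<And>A. A \<in> Ax \<Longrightarrow> negative A"
  shows "derives Ax \<Gamma> A \<Longrightarrow> (\<And>B. B \<in> set \<Gamma> \<Longrightarrow> slash Ax \<Delta> B \<sigma>) \<Longrightarrow> slash Ax \<Delta> A \<sigma>"
proof (induction arbitrary: \<sigma> rule: derives.induct)
  \<comment> \<open>Supplies the derivability part of the clauses for implication and
    \<open>Forall\<close>: slashed hypotheses are derivable, hence can be cut from the substituted
    derivation.\<close>
  have derivable: "derives Ax \<Delta> (subst \<sigma> A)"
    if "derives Ax \<Gamma> A" and "\<And>B. B \<in> set \<Gamma> \<Longrightarrow> slash Ax \<Delta> B \<sigma>" for \<Gamma> A \<sigma>
    using derives_cut[OF derives_subst[OF closed that(1), of \<sigma>], of \<Delta>] that(2)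
    by (auto intro: slash_imp_derives)
  {
    case (Axiom A \<Gamma>)
    then show ?case by (intro negative_slash neg derives.Axiom closed)
  next
    case (BotE \<Gamma> A)
    then show ?case by (auto intro: slash_explosion)
  next
    case (OrE \<Gamma> A B C)
    from OrE.IH(1)[OF OrE.prems] consider "slash Ax \<Delta> A \<sigma>" | "slash Ax \<Delta> B \<sigma>"
      by auto
    then show ?case
      by cases (use OrE.IH(2,3) OrE.prems in auto)
  next
    case (ImpI A \<Gamma> B)
    have "derives Ax \<Delta> (subst \<sigma> (A \<^bold>\<longrightarrow> B))"
      using ImpI.hyps ImpI.prems by (intro derivable derives.ImpI)
    moreover have "slash Ax \<Delta> B \<sigma>" if "slash Ax \<Delta> A \<sigma>"
      using ImpI.prems that by (intro ImpI.IH) auto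
    ultimately show ?case by simp
  next
    case (AllI \<Gamma> A)
    have "derives Ax \<Delta> (subst \<sigma> (Forall A))"
      using AllI.hyps AllI.prems by (intro derivable derives.AllI)
    \<comment> \<open>Lifted hypotheses do not see the value \<open>t\<close> of the new variable,
      so they remain slashed.\<close>
    moreover have "slash Ax \<Delta> A (case_nat t \<sigma>)" for t
      using AllI.prems by (intro AllI.IH) (auto simp: slash_lift)
    ultimately show ?case by simp
  next
    case (AllE \<Gamma> A t)
    then show ?case by (simp add: slash_inst)
  next
    case (ExI \<Gamma> t A)
    then show ?case by (auto simp: slash_inst)
  next
    case (ExE \<Gamma> A C)
    from ExE.IH(1)[OF ExE.prems] obtain t where "slash Ax \<Delta> A (case_nat t \<sigma>)"
      by auto
    with ExE.prems have "slash Ax \<Delta> (lift C) (case_nat t \<sigma>)"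
      by (intro ExE.IH(2)) (auto simp: slash_lift)
    then show ?case by (simp add: slash_lift)
  next
    case (EqI \<Gamma> t)
    show ?case by (simp add: derives.EqI)
  next
    case (EqE \<Gamma> s t A)
    \<comment> \<open>Variable 0 is the slot for the two equal terms; \<open>\<sigma>\<close> is
      shifted past it, so filling the slot with \<open>u\<close> gives
      \<open>case_nat u \<sigma>\<close>.\<close>
    define \<rho> where "\<rho> = case_nat (Var 0) (\<lambda>n. subst_tm (\<lambda>i. Var (Suc i)) (\<sigma> n))"
    have \<rho>: "(\<lambda>n. subst_tm (case_nat u Var) (\<rho> n)) = case_nat u \<sigma>" for u
      by (simp add: \<rho>_def subst_tm_case_nat subst_tm_comp)
    have "derives Ax \<Delta> (Eq (subst_tm \<sigma> s) (subst_tm \<sigma> t))"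
      using EqE.IH(1)[OF EqE.prems] by simp
    from slash_eq[OF this, of A \<rho>] EqE.IH(2)[OF EqE.prems] show ?case
      by (simp only: \<rho> slash_inst)
  }
qed auto


section \<open>Term extraction\<close>

lemma subst_TBet:
  "subst \<sigma> (TBet a b c) = TBet (subst_tm \<sigma> a) (subst_tm \<sigma> b) (subst_tm \<sigma> c)"
  by (simp add: TBet_def)

lemma subst_Col:
  "subst \<sigma> (Col a b c) = Col (subst_tm \<sigma> a) (subst_tm \<sigma> b) (subst_tm \<sigma> c)"
  by (simp add: Col_def subst_TBet)

lemma subst_SameOrder:
  "subst \<sigma> (SameOrder a b c d) =
    SameOrder (subst_tm \<sigma> a) (subst_tm \<sigma> b) (subst_tm \<sigma> c) (subst_tm \<sigma> d)"
  by (simp add: SameOrder_def subst_TBet)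

text \<open>The axioms are schemes over arbitrary terms, and the defined relations and Skolem terms
  commute with substitution.\<close>

lemma tarski_subst: "A \<in> tarski \<Longrightarrow> subst \<sigma> A \<in> tarski"
  by (induction rule: tarski.induct)
    (simp_all add: subst_TBet subst_Col subst_SameOrder tarski.intros)

text \<open>Skolem functions take the place of existentials, and betweenness and collinearity are
  expressed with negation and conjunction instead of disjunction.\<close>

lemma tarski_negative: "A \<in> tarski \<Longrightarrow> negative A"
  by (induction rule: tarski.induct) (simp_all add: TBet_def Col_def SameOrder_def)

theorem theorem13p1:
  fixes P \<phi> :: fm and xs :: "nat list"
  assumes "negative P"
    and "fv P \<subseteq> set xs"
    and "fv (Exists \<phi>) \<subseteq> set xs"
    and "provable (P \<^bold>\<longrightarrow> Exists \<phi>)"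
  shows "\<exists>t. fv_tm t \<subseteq> set xs \<and> provable (P \<^bold>\<longrightarrow> inst t \<phi>)"
proof -
  have P: "derives tarski [P] P"
    by (simp add: derives.Hyp)
  have "derives tarski [P] (P \<^bold>\<longrightarrow> Exists \<phi>)"
    using assms(4) derives_weaken[of tarski "[]"] by (simp add: provable_def)
  then have ex: "derives tarski [P] (Exists \<phi>)"
    using P by (rule derives.ImpE)
  have "slash tarski [P] P Var"
    using assms(1) P by (simp add: negative_slash)
  then have "slash tarski [P] (Exists \<phi>) Var"
    using slash_sound[OF tarski_subst tarski_negative ex] by simp
  then obtain t where "slash tarski [P] \<phi> (case_nat t Var)"
    by auto
  then have "derives tarski [] (P \<^bold>\<longrightarrow> inst t \<phi>)"
    by (simp add: inst_eq derives.ImpI slash_imp_derives)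
  define \<theta> where "\<theta> n = (if n \<in> set xs then Var n else Alpha)" for n
  have \<theta>_P: "subst \<theta> P = P"
    using subst_cong[of P \<theta> Var] assms(2) by (simp add: \<theta>_def subset_iff)
  \<comment> \<open>Variable 0 is the bound one, fixed by \<open>up\<close>; variable
    \<open>Suc m\<close> of \<open>\<phi>\<close> is the free variable \<open>m\<close> of
    \<open>Exists \<phi>\<close>, which lies in \<open>xs\<close>.\<close>
  have "up \<theta> n = Var n" if "n \<in> fv \<phi>" for n
    using that assms(3) by (cases n) (auto simp: \<theta>_def)
  then have \<theta>_\<phi>: "subst (up \<theta>) \<phi> = \<phi>"
    using subst_cong[of \<phi> "up \<theta>" Var] by simp
  \<comment> \<open>Applying \<open>\<theta>\<close> to the whole derivation changes only the
    witness, since \<open>P\<close> and \<open>\<phi>\<close> are fixed.\<close>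
  have "provable (P \<^bold>\<longrightarrow> inst (subst_tm \<theta> t) \<phi>)"
    using derives_subst[OF tarski_subst \<open>derives tarski [] (P \<^bold>\<longrightarrow> inst t \<phi>)\<close>, of \<theta>]
    by (simp add: provable_def subst_inst_up \<theta>_P \<theta>_\<phi>)
  moreover have "fv_tm (subst_tm \<theta> t) \<subseteq> set xs"
    by (auto simp: fv_tm_subst_tm \<theta>_def split: if_splits)
  ultimately show ?thesis by blast
qed

end
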